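(* Let $F=\langle W,R,S\rangle$ be a finite $\mathbf{IL}$-frame. Then $F$ validates all instances of Beklemishev's principle $\mathsf{B}$, i.e. $F\models (A\rhd B)\to (A\wedge\Box C\rhd B\wedge\Box C)$ for all $A\in\mathsf{ES}_2$ and all modal interpretability formulas $B,C$, if and only if $F\models\mathcal{C}_i$ for every $i\in\omega$.
   Context: Modal interpretability formulas $\mathcal A$ are built from propositional variables and $\bot$ using $\wedge,\to$, a unary modality $\Box$ and a binary modality $\rhd$; $\neg,\vee,\top,\Diamond=\neg\Box\neg$ are the usual abbreviations. $\rhd$ binds weaker than $\wedge,\vee$ and stronger than $\to$. The class $\mathsf{ES}_2$ of formulas is given by the grammar $\mathsf{ES}_2 ::= \Box\mathcal A \mid \neg\Box\mathcal A\mid \mathsf{ES}_2\wedge\mathsf{ES}_2\mid\mathsf{ES}_2\vee\mathsf{ES}_2\mid\neg(\mathsf{ES}_2\rhd\mathcal A)$, where $\mathcal A$ ranges over all modal interpretability formulas. An $\mathbf{IL}$-frame (Veltman frame) is a triple $\langle W,R,S\rangle$ with $W$ nonempty, $R$ a binary relation on $W$, and $S=(S_x)_{x\in W}$ a family of binary relations on $W$ such that: (1) $R$ is transitive and conversely well-founded; (2) $yS_xz\Rightarrow xRy$ and $xRz$; (3) $xRy\Rightarrow yS_xy$; (4) $xRyRz\Rightarrow yS_xz$; (5) $uS_xvS_xw\Rightarrow uS_xw$. An $\mathbf{IL}$-model adds a forcing relation $\Vdash$ between worlds and propositional variables, extended to boolean connectives as usual and by: $w\Vdash\Box A$ iff $v\Vdash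 A$ for all $v$ with $wRv$; $w\Vdash A\rhd B$ iff for all $u$ with $wRu$ and $u\Vdash A$ there is $v$ with $uS_wv$ and $v\Vdash B$. $F\models A$ means that $A$ is forced at every world of $F$ under every valuation. Notation: $x{\uparrow}=\{y\mid xRy\}$ and $yS_x{\uparrow}=\{z\mid yS_xz\}$. Define relations $\mathcal S_i$ on $W$ by $\mathcal S_0(b,u):\Leftrightarrow b{\uparrow}=u{\uparrow}$, and $\mathcal S_{n+1}(b,u):\Leftrightarrow \mathcal S_n(b,u)\wedge\forall c\,\big(bRc\to\exists c'\,(uRc'\wedge\mathcal S_n(c,c')\wedge c'S_u{\uparrow}\subseteq cS_b{\uparrow})\big)$. The condition $\mathcal C_i$ is: $\forall a,b\,\big(aRb\to\exists u\,(bS_au\wedge\mathcal S_i(b,u)\wedge\forall d,e\,(uS_ad\wedge dRe\to bRe))\big)$. *)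

theory Defs
  imports Main
begin

datatype form =
    Var nat
  | Bot  ("\<^bold>\<bottom>")
  | Conj form form  (infixr "\<^bold>\<and>" 75)
  | Imp form form  (infixr "\<^bold>\<longrightarrow>" 60)
  | Box form  ("\<^bold>\<box>_" [90] 90)
  | Rhd form form  (infix "\<rhd>" 65)

definition Neg :: "form \<Rightarrow> form"  ("\<^bold>\<not>_" [90] 90)
  where "\<^bold>\<not>A = (A \<^bold>\<longrightarrow> \<^bold>\<bottom>)"

definition Disj :: "form \<Rightarrow> form \<Rightarrow> form"  (infixr "\<^bold>\<or>" 70)
  where "A \<^bold>\<or> B = (\<^bold>\<not>A \<^bold>\<longrightarrow> B)"

inductive_set ES2 :: "form set" where
  ES2_Box: "\<^bold>\<box>A \<in> ES2"
| ES2_Neg_Box: "\<^bold>\<not>\<^bold>\<box>A \<in> ES2"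
| ES2_Conj: "D \<in> ES2 \<Longrightarrow> E \<in> ES2 \<Longrightarrow> D \<^bold>\<and> E \<in> ES2"
| ES2_Disj: "D \<in> ES2 \<Longrightarrow> E \<in> ES2 \<Longrightarrow> D \<^bold>\<or> E \<in> ES2"
| ES2_Neg_Rhd: "D \<in> ES2 \<Longrightarrow> \<^bold>\<not>(D \<rhd> A) \<in> ES2"

text \<open>
  The set \<open>W\<close> of worlds is an explicit carrier inside the type of worlds. The family \<open>S\<close> is
  indexed by \<open>W\<close>: the values \<open>S x\<close> for \<open>x \<notin> W\<close> are irrelevant and left unconstrained.
\<close>

locale IL_frame =
  fixes W :: "'w set" and R :: "'w rel" and S :: "'w \<Rightarrow> 'w rel"
  assumes W_nonempty: "W \<noteq> {}"
    and R_on_W: "R \<subseteq> W \<times> W"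
    and S_on_W: "x \<in> W \<Longrightarrow> S x \<subseteq> W \<times> W"
    and R_trans: "trans R"
    and R_conv_wf: "wf (R\<inverse>)"
    and S_in_R: "x \<in> W \<Longrightarrow> (y, z) \<in> S x \<Longrightarrow> (x, y) \<in> R \<and> (x, z) \<in> R"
    and S_refl: "(x, y) \<in> R \<Longrightarrow> (y, y) \<in> S x"
    and R_in_S: "(x, y) \<in> R \<Longrightarrow> (y, z) \<in> R \<Longrightarrow> (y, z) \<in> S x"
    and S_trans: "x \<in> W \<Longrightarrow> (u, v) \<in> S x \<Longrightarrow> (v, w) \<in> S x \<Longrightarrow> (u, w) \<in> S x"

text \<open>Worlds accessible from a world of \<open>W\<close> lie in \<open>W\<close>, so the quantifiers below need no bound.\<close>

primrec forces :: "'w rel \<Rightarrow> ('w \<Rightarrow> 'w rel) \<Rightarrow> ('w \<Rightarrow> nat \<Rightarrow> bool) \<Rightarrow> 'w \<Rightarrow> form \<Rightarrow> bool" where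
  "forces R S V w (Var p) = V w p"
| "forces R S V w \<^bold>\<bottom> = False"
| "forces R S V w (A \<^bold>\<and> B) = (forces R S V w A \<and> forces R S V w B)"
| "forces R S V w (A \<^bold>\<longrightarrow> B) = (forces R S V w A \<longrightarrow> forces R S V w B)"
| "forces R S V w (\<^bold>\<box>A) = (\<forall>v. (w, v) \<in> R \<longrightarrow> forces R S V v A)"
| "forces R S V w (A \<rhd> B) =
    (\<forall>u. (w, u) \<in> R \<and> forces R S V u A \<longrightarrow> (\<exists>v. (u, v) \<in> S w \<and> forces R S V v B))"

definition validates :: "'w set \<Rightarrow> 'w rel \<Rightarrow> ('w \<Rightarrow> 'w rel) \<Rightarrow> form \<Rightarrow> bool"
  where "validates W R S A \<longleftrightarrow> (\<forall>V. \<forall>w\<in>W. forces R S V w A)"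

primrec sim :: "'w rel \<Rightarrow> ('w \<Rightarrow> 'w rel) \<Rightarrow> nat \<Rightarrow> 'w \<Rightarrow> 'w \<Rightarrow> bool" where
  "sim R S 0 b u \<longleftrightarrow> R `` {b} = R `` {u}"
| "sim R S (Suc n) b u \<longleftrightarrow> sim R S n b u \<and>
    (\<forall>c. (b, c) \<in> R \<longrightarrow>
      (\<exists>c'. (u, c') \<in> R \<and> sim R S n c c' \<and> S u `` {c'} \<subseteq> S b `` {c}))"

definition cond_C :: "'w rel \<Rightarrow> ('w \<Rightarrow> 'w rel) \<Rightarrow> nat \<Rightarrow> bool" where
  "cond_C R S i \<longleftrightarrow> (\<forall>a b. (a, b) \<in> R \<longrightarrow>
    (\<exists>u. (b, u) \<in> S a \<and> sim R S i b u \<and>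
      (\<forall>d e. (u, d) \<in> S a \<and> (d, e) \<in> R \<longrightarrow> (b, e) \<in> R)))"

end

theory Submission
  imports Defs
begin

text \<open>
  The relation \<open>sim R S n b u\<close> is a one-sided, depth-bounded bisimulation that measures exactly what
  \<open>ES2\<close> formulas can see: boxed formulas see only the set of successors, and each
  \<open>\<^bold>\<not>(D \<rhd> E)\<close> consumes one round. Two facts make this precise.

  \<^item> Preservation (\<open>ES2_preserved_by_sim\<close>): each \<open>A \<in> ES2\<close> is transferred from \<open>b\<close> to \<open>u\<close> by
    \<open>sim R S n b u\<close> once \<open>n\<close> is large enough.
  \<^item> Characterisation (\<open>ES2_characterises_sim\<close>): if a valuation makes all sets of worlds definable,
    then the set of all \<open>u\<close> with \<open>sim R S n b u\<close> is definable by a formula of \<open>ES2\<close>. A finite frame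
    has such a valuation.

  Assume all conditions \<open>cond_C R S i\<close>, and let \<open>a\<close> force \<open>A \<rhd> B\<close> and its successor \<open>b\<close> force
  \<open>A \<^bold>\<and> \<^bold>\<box>C\<close>. The condition gives a world \<open>u\<close> that still forces \<open>A\<close>, by preservation. So \<open>u\<close> has an
  \<open>S a\<close>-successor \<open>v\<close> forcing \<open>B\<close>, and \<open>v\<close> forces \<open>\<^bold>\<box>C\<close> because its successors are successors
  of \<open>b\<close>.

  Conversely, let the principle be valid and let \<open>b\<close> be a successor of \<open>a\<close>. Take for \<open>A\<close> the
  characteristic formula of the worlds \<open>u\<close> with \<open>sim R S i b u\<close>, for \<open>C\<close> a formula defining the
  successors of \<open>b\<close>, and for \<open>B\<close> a formula true at the worlds that are outside \<open>S a `` {b}\<close> or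
  refute \<open>\<^bold>\<box>C\<close>. Then \<open>b\<close> forces \<open>A \<^bold>\<and> \<^bold>\<box>C\<close> but no \<open>S a\<close>-successor of \<open>b\<close> forces
  \<open>B \<^bold>\<and> \<^bold>\<box>C\<close>, so by the principle \<open>A \<rhd> B\<close> fails at \<open>a\<close>. A world \<open>u\<close> witnessing this failure
  is the one that the condition asks for: all its \<open>S a\<close>-successors, itself included, lie in
  \<open>S a `` {b}\<close> and force \<open>\<^bold>\<box>C\<close>.
\<close>

lemma forces_Neg [simp]: "forces R S V w (\<^bold>\<not>A) \<longleftrightarrow> \<not> forces R S V w A"
  by (simp add: Neg_def)

lemma forces_Disj [simp]:
  "forces R S V w (A \<^bold>\<or> B) \<longleftrightarrow> forces R S V w A \<or> forces R S V w B"
  by (auto simp: Disj_def)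

lemma sim_refl: "sim R S n b b"
  by (induction n arbitrary: b) auto

lemma sim_antimono: "sim R S n b u \<Longrightarrow> m \<le> n \<Longrightarrow> sim R S m b u"
  by (induction n) (auto simp: le_Suc_eq)

lemma sim_common_level:
  assumes "\<exists>m. \<forall>b u. sim R S m b u \<longrightarrow> P b \<longrightarrow> P u"
    and "\<exists>n. \<forall>b u. sim R S n b u \<longrightarrow> Q b \<longrightarrow> Q u"
  shows "\<exists>n. \<forall>b u. sim R S n b u \<longrightarrow> (P b \<longrightarrow> P u) \<and> (Q b \<longrightarrow> Q u)"
proof -
  obtain m n where P: "\<And>b u. sim R S m b u \<Longrightarrow> P b \<Longrightarrow> P u"
    and Q: "\<And>b u. sim R S n b u \<Longrightarrow> Q b \<Longrightarrow> Q u"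
    using assms by blast
  have "sim R S m b u" "sim R S n b u" if "sim R S (max m n) b u" for b u
    by (rule sim_antimono [OF that], simp)+
  then show ?thesis using P Q by blast
qed

text \<open>
  For \<open>\<^bold>\<not>(D \<rhd> E)\<close> true at \<open>b\<close>, some successor \<open>c\<close> of \<open>b\<close> forces \<open>D\<close> and sees no \<open>E\<close> along
  \<open>S b\<close>. The world \<open>c'\<close> answering \<open>c\<close> forces \<open>D\<close> by induction, and
  \<open>S u `` {c'} \<subseteq> S b `` {c}\<close> keeps \<open>E\<close> out of its sight. The bound \<open>n\<close> is the nesting depth of such
  subformulas.
\<close>

lemma ES2_preserved_by_sim:
  assumes "A \<in> ES2"
  shows "\<exists>n. \<forall>b u. sim R S n b u \<longrightarrow> forces R S V b A \<longrightarrow> forces R S V u A"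
  using assms
proof induction
  case (ES2_Box A)
  show ?case by (rule exI [of _ 0]) auto
next
  case (ES2_Neg_Box A)
  show ?case by (rule exI [of _ 0]) auto
next
  case (ES2_Conj D E)
  from sim_common_level [OF this(3,4)] show ?case by (simp only: forces.simps) blast
next
  case (ES2_Disj D E)
  from sim_common_level [OF this(3,4)] show ?case by (simp only: forces_Disj) blast
next
  case (ES2_Neg_Rhd D A)
  then obtain n where n: "\<And>b u. sim R S n b u \<Longrightarrow> forces R S V b D \<Longrightarrow> forces R S V u D"
    by blast
  have "forces R S V u (\<^bold>\<not>(D \<rhd> A))"
    if sim: "sim R S (Suc n) b u" and b: "forces R S V b (\<^bold>\<not>(D \<rhd> A))" for b u
  proof -
    obtain c where c: "(b, c) \<in> R" "forces R S V c D"
        "\<And>v. (c, v) \<in> S b \<Longrightarrow> \<not> forces R S V v A"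
      using b by auto
    obtain c' where c': "(u, c') \<in> R" "sim R S n c c'" "S u `` {c'} \<subseteq> S b `` {c}"
      using sim c(1) by auto
    have "forces R S V c' D" using n c'(2) c(2) by blast
    with c' c(3) show ?thesis by auto
  qed
  then show ?case by blast
qed

text \<open>
  Injecting the finite powerset of \<open>W\<close> into the variables gives every set of worlds a variable of
  its own.
\<close>

lemma finite_all_sets_definable:
  assumes "finite W"
  shows "\<exists>V. \<forall>P. \<exists>A. \<forall>w\<in>W. forces R S V w A \<longleftrightarrow> P w"
proof -
  obtain g :: "'a set \<Rightarrow> nat" where g: "inj_on g (Pow W)"
    using finite_imp_inj_to_nat_seg [of "Pow W"] assms by auto
  define V where "V w k \<longleftrightarrow> (\<exists>X\<subseteq>W. g X = k \<and> w \<in> X)" for w k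
  have "\<forall>w\<in>W. forces R S V w (Var (g {w\<in>W. P w})) \<longleftrightarrow> P w" for P
  proof
    fix w assume w: "w \<in> W"
    have "X = {w\<in>W. P w}" if "X \<subseteq> W" "g X = g {w\<in>W. P w}" for X
      using that by (intro inj_onD [OF g]) auto
    then have "V w (g {w\<in>W. P w}) \<longleftrightarrow> w \<in> {w\<in>W. P w}"
      unfolding V_def by (metis Collect_subset)
    then show "forces R S V w (Var (g {w\<in>W. P w})) \<longleftrightarrow> P w"
      using w by simp
  qed
  then show ?thesis by blast
qed

lemma ES2_finite_conjunction:
  assumes "finite I"
    and "\<And>i. i \<in> I \<Longrightarrow> \<exists>A\<in>ES2. \<forall>w\<in>W. forces R S V w A \<longleftrightarrow> P i w"
  shows "\<exists>A\<in>ES2. \<forall>w\<in>W. forces R S V w A \<longleftrightarrow> (\<forall>i\<in>I. P i w)"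
  using assms
proof (induction I)
  case empty
  have "\<forall>w\<in>W. forces R S V w (\<^bold>\<box>(\<^bold>\<bottom> \<^bold>\<longrightarrow> \<^bold>\<bottom>))" by simp
  then show ?case using ES2_Box by blast
next
  case (insert i I)
  obtain A where A: "A \<in> ES2" "\<forall>w\<in>W. forces R S V w A \<longleftrightarrow> P i w"
    using insert.prems by blast
  obtain B where B: "B \<in> ES2" "\<forall>w\<in>W. forces R S V w B \<longleftrightarrow> (\<forall>i\<in>I. P i w)"
    using insert.IH insert.prems by blast
  have "\<forall>w\<in>W. forces R S V w (A \<^bold>\<and> B) \<longleftrightarrow> (\<forall>j\<in>insert i I. P j w)"
    using A(2) B(2) by simp
  then show ?case using ES2_Conj [OF A(1) B(1)] by blast
qed

text \<open>
  For \<open>n = 0\<close>, a box formula bounds the successors of \<open>u\<close> by those of \<open>b\<close>, and one negated box for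
  each successor of \<open>b\<close> gives the other inclusion. In the step, the demand raised by a successor
  \<open>c\<close> of \<open>b\<close> is expressed by \<open>\<^bold>\<not>(D \<rhd> E)\<close>, where \<open>D\<close> is the characteristic formula of level \<open>n\<close>
  for \<open>c\<close> and \<open>E\<close> defines the complement of \<open>S b `` {c}\<close>.
\<close>

lemma ES2_characterises_sim:
  assumes frame: "IL_frame W R S" and fin: "finite W"
    and definable: "\<And>P. \<exists>A. \<forall>w\<in>W. forces R S V w A \<longleftrightarrow> P w"
  shows "\<exists>A\<in>ES2. \<forall>u\<in>W. forces R S V u A \<longleftrightarrow> sim R S n b u"
proof -
  interpret IL_frame W R S by (fact frame)
  have R_W: "y \<in> W" if "(x, y) \<in> R" for x y
    using R_on_W that by blast
  have S_W: "z \<in> W" if "x \<in> W" "(y, z) \<in> S x" for x y z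
    using S_on_W that by blast
  have fin_succ: "finite (R `` {b})" for b
    by (rule finite_subset [OF _ fin]) (use R_W in blast)
  show ?thesis
  proof (induction n arbitrary: b)
    case 0
    obtain D where D: "\<And>w. w \<in> W \<Longrightarrow> forces R S V w D \<longleftrightarrow> w \<in> R `` {b}"
      using definable [of "\<lambda>w. w \<in> R `` {b}"] by blast
    have "\<exists>A\<in>ES2. \<forall>u\<in>W. forces R S V u A \<longleftrightarrow> (\<forall>c\<in>R `` {b}. c \<in> R `` {u})"
    proof (rule ES2_finite_conjunction [OF fin_succ])
      fix c
      obtain E where E: "\<And>w. w \<in> W \<Longrightarrow> forces R S V w E \<longleftrightarrow> w \<noteq> c"
        using definable [of "\<lambda>w. w \<noteq> c"] by blast
      have "\<forall>u\<in>W. forces R S V u (\<^bold>\<not>\<^bold>\<box>E) \<longleftrightarrow> c \<in> R `` {u}"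
        unfolding forces_Neg forces.simps(5) using E R_W by blast
      then show "\<exists>A\<in>ES2. \<forall>u\<in>W. forces R S V u A \<longleftrightarrow> c \<in> R `` {u}"
        using ES2_Neg_Box by blast
    qed
    then obtain A where A: "A \<in> ES2"
        "\<And>u. u \<in> W \<Longrightarrow> forces R S V u A \<longleftrightarrow> R `` {b} \<subseteq> R `` {u}"
      unfolding subset_eq by blast
    have "forces R S V u (\<^bold>\<box>D \<^bold>\<and> A) \<longleftrightarrow> sim R S 0 b u" if "u \<in> W" for u
    proof -
      have "forces R S V u (\<^bold>\<box>D) \<longleftrightarrow> R `` {u} \<subseteq> R `` {b}"
        unfolding forces.simps(5) using D R_W by blast
      then show ?thesis using A(2) [OF that] by auto
    qed
    then show ?case using ES2_Conj [OF ES2_Box A(1)] by blast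
  next
    case (Suc n)
    define step where "step c u \<longleftrightarrow>
      (\<exists>c'. (u, c') \<in> R \<and> sim R S n c c' \<and> S u `` {c'} \<subseteq> S b `` {c})" for c u
    have "\<exists>A\<in>ES2. \<forall>u\<in>W. forces R S V u A \<longleftrightarrow> (\<forall>c\<in>R `` {b}. step c u)"
    proof (rule ES2_finite_conjunction [OF fin_succ])
      fix c
      obtain D where D: "D \<in> ES2" "\<And>w. w \<in> W \<Longrightarrow> forces R S V w D \<longleftrightarrow> sim R S n c w"
        using Suc.IH [of c] by blast
      obtain E where E: "\<And>w. w \<in> W \<Longrightarrow> forces R S V w E \<longleftrightarrow> w \<notin> S b `` {c}"
        using definable [of "\<lambda>w. w \<notin> S b `` {c}"] by blast
      have "forces R S V u (\<^bold>\<not>(D \<rhd> E)) \<longleftrightarrow> step c u" if u: "u \<in> W" for u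
      proof -
        have "forces R S V u (\<^bold>\<not>(D \<rhd> E)) \<longleftrightarrow>
            (\<exists>c'. (u, c') \<in> R \<and> forces R S V c' D \<and> (\<forall>v. (c', v) \<in> S u \<longrightarrow> \<not> forces R S V v E))"
          by auto
        also have "\<dots> \<longleftrightarrow> step c u"
          unfolding step_def using D(2) E R_W S_W [OF u] by blast
        finally show ?thesis .
      qed
      then show "\<exists>A\<in>ES2. \<forall>u\<in>W. forces R S V u A \<longleftrightarrow> step c u"
        using ES2_Neg_Rhd [OF D(1)] by blast
    qed
    then obtain A where A: "A \<in> ES2"
        "\<And>u. u \<in> W \<Longrightarrow> forces R S V u A \<longleftrightarrow> (\<forall>c\<in>R `` {b}. step c u)"
      by blast
    obtain A' where A': "A' \<in> ES2" "\<And>u. u \<in> W \<Longrightarrow> forces R S V u A' \<longleftrightarrow> sim R S n b u"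
      using Suc.IH [of b] by blast
    have "\<forall>u\<in>W. forces R S V u (A' \<^bold>\<and> A) \<longleftrightarrow> sim R S (Suc n) b u"
      using A(2) A'(2) by (auto simp: step_def)
    then show ?case using ES2_Conj [OF A'(1) A(1)] by blast
  qed
qed

lemma cond_C_imp_principle_B:
  assumes frame: "IL_frame W R S" and C: "\<And>i. cond_C R S i" and A: "A \<in> ES2"
  shows "validates W R S ((A \<rhd> B) \<^bold>\<longrightarrow> (A \<^bold>\<and> \<^bold>\<box>C \<rhd> B \<^bold>\<and> \<^bold>\<box>C))"
proof -
  interpret IL_frame W R S by (fact frame)
  have "\<exists>v. (b, v) \<in> S a \<and> forces R S V v (B \<^bold>\<and> \<^bold>\<box>C)"
    if a: "a \<in> W" "forces R S V a (A \<rhd> B)"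
      and b: "(a, b) \<in> R" "forces R S V b (A \<^bold>\<and> \<^bold>\<box>C)" for V a b
  proof -
    obtain n where n: "\<And>b u. sim R S n b u \<Longrightarrow> forces R S V b A \<Longrightarrow> forces R S V u A"
      using ES2_preserved_by_sim [OF A, of R S V] by blast
    obtain u where u: "(b, u) \<in> S a" "sim R S n b u"
        "\<And>d e. (u, d) \<in> S a \<Longrightarrow> (d, e) \<in> R \<Longrightarrow> (b, e) \<in> R"
      using C [of n] b(1) unfolding cond_C_def by blast
    have "forces R S V u A" using n [OF u(2)] b(2) by simp
    moreover have "(a, u) \<in> R" using S_in_R [OF a(1) u(1)] by simp
    ultimately obtain v where v: "(u, v) \<in> S a" "forces R S V v B"
      using a(2) by auto
    have "(b, v) \<in> S a" using S_trans [OF a(1) u(1) v(1)] .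
    then show ?thesis using v u(3) b(2) by auto
  qed
  then show ?thesis unfolding validates_def by simp
qed

lemma principle_B_imp_cond_C:
  assumes frame: "IL_frame W R S" and fin: "finite W"
    and valid: "\<And>A B C. A \<in> ES2 \<Longrightarrow> validates W R S ((A \<rhd> B) \<^bold>\<longrightarrow> (A \<^bold>\<and> \<^bold>\<box>C \<rhd> B \<^bold>\<and> \<^bold>\<box>C))"
  shows "cond_C R S i"
  unfolding cond_C_def
proof (intro allI impI)
  interpret IL_frame W R S by (fact frame)
  fix a b assume ab: "(a, b) \<in> R"
  then have W: "a \<in> W" "b \<in> W" using R_on_W by auto
  obtain V where V: "\<And>P. \<exists>A. \<forall>w\<in>W. forces R S V w A \<longleftrightarrow> P w"
    using finite_all_sets_definable [OF fin] by blast
  obtain A where A: "A \<in> ES2" "\<And>u. u \<in> W \<Longrightarrow> forces R S V u A \<longleftrightarrow> sim R S i b u"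
    using ES2_characterises_sim [OF frame fin V, of i b] by blast
  obtain C where C: "\<And>w. w \<in> W \<Longrightarrow> forces R S V w C \<longleftrightarrow> (b, w) \<in> R"
    using V [of "\<lambda>w. (b, w) \<in> R"] by blast
  obtain D where D: "\<And>w. w \<in> W \<Longrightarrow> forces R S V w D \<longleftrightarrow> (b, w) \<notin> S a"
    using V [of "\<lambda>w. (b, w) \<notin> S a"] by blast
  have box_C: "forces R S V w (\<^bold>\<box>C) \<longleftrightarrow> R `` {w} \<subseteq> R `` {b}" for w
    using C R_on_W by auto
  have b: "forces R S V b (A \<^bold>\<and> \<^bold>\<box>C)"
    using A(2) [OF W(2)] box_C [of b] sim_refl [of R S i b] by simp
  have no_B: "\<not> forces R S V v ((D \<^bold>\<or> \<^bold>\<not>\<^bold>\<box>C) \<^bold>\<and> \<^bold>\<box>C)" if "(b, v) \<in> S a" for v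
    using D that S_on_W [OF W(1)] by auto
  have "\<not> forces R S V a (A \<rhd> D \<^bold>\<or> \<^bold>\<not>\<^bold>\<box>C)"
  proof
    assume "forces R S V a (A \<rhd> D \<^bold>\<or> \<^bold>\<not>\<^bold>\<box>C)"
    then have "forces R S V a (A \<^bold>\<and> \<^bold>\<box>C \<rhd> (D \<^bold>\<or> \<^bold>\<not>\<^bold>\<box>C) \<^bold>\<and> \<^bold>\<box>C)"
      using valid [OF A(1)] W(1) unfolding validates_def forces.simps(4) by blast
    then show False
      using ab b no_B unfolding forces.simps(6) by blast
  qed
  then obtain u where u: "(a, u) \<in> R" "forces R S V u A"
      and not_B: "\<And>v. (u, v) \<in> S a \<Longrightarrow> \<not> forces R S V v (D \<^bold>\<or> \<^bold>\<not>\<^bold>\<box>C)"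
    unfolding forces.simps(6) by blast
  have "u \<in> W" using u(1) R_on_W by blast
  \<comment> \<open>As \<open>A\<close> cannot restrict attention to \<open>S a `` {b}\<close>, the disjunct \<open>D\<close> of the consequent does
    so: any other \<open>u\<close> would satisfy the consequent itself.\<close>
  have "(b, u) \<in> S a"
    using not_B [OF S_refl [OF u(1)]] D [OF \<open>u \<in> W\<close>] by simp
  moreover have "sim R S i b u" using A(2) [OF \<open>u \<in> W\<close>] u(2) by simp
  moreover have "(b, e) \<in> R" if "(u, d) \<in> S a" "(d, e) \<in> R" for d e
  proof -
    have "forces R S V d (\<^bold>\<box>C)" using not_B [OF that(1)] by simp
    then show ?thesis using box_C [of d] that(2) by blast
  qed
  ultimately show "\<exists>u. (b, u) \<in> S a \<and> sim R S i b u \<and>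
      (\<forall>d e. (u, d) \<in> S a \<and> (d, e) \<in> R \<longrightarrow> (b, e) \<in> R)"
    by blast
qed

theorem theorem6p7:
  fixes W :: "'w set" and R :: "'w rel" and S :: "'w \<Rightarrow> 'w rel"
  assumes "IL_frame W R S" and "finite W"
  shows "(\<forall>A\<in>ES2. \<forall>B C.
            validates W R S ((A \<rhd> B) \<^bold>\<longrightarrow> (A \<^bold>\<and> \<^bold>\<box>C \<rhd> B \<^bold>\<and> \<^bold>\<box>C)))
         \<longleftrightarrow> (\<forall>i. cond_C R S i)"
  using cond_C_imp_principle_B [OF assms(1)] principle_B_imp_cond_C [OF assms] by blast

end
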